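(* Let $\star$ be a semistar operation on an integral domain $D$ with quotient field $K$. Suppose that $D^\star=D^{\widetilde{\star}}$. Let $I$ be a nonzero $D$-submodule of $K$. Then $I$ is quasi-$\star_f$-invertible if and only if $I$ is quasi-$\widetilde{\star}$-invertible.
   Context: Let $D$ be an integral domain with quotient field $K$; $\overline{F}(D)$ is the set of nonzero $D$-submodules of $K$. A semistar operation on $D$ is a map $\star:\overline{F}(D)\to\overline{F}(D)$, $E\mapsto E^\star$, such that for all $0\ne x\in K$ and $E,F\in\overline{F}(D)$: $(xE)^\star=xE^\star$; $E\subseteq F$ implies $E^\star\subseteq F^\star$; $E\subseteq E^\star$ and $(E^\star)^\star=E^\star$. The semistar operation of finite type associated to $\star$ is $\star_f$, defined by $E^{\star_f}=\bigcup\{F^\star : F\subseteq E,\ F \text{ a nonzero finitely generated } D\text{-submodule of } K\}$. A nonzero ideal $I\subseteq D$ is a quasi-$\star_f$-ideal if $I^{\star_f}\cap D=I$, and $\mathcal{M}(\star_f)$ denotes the set of maximal elements of the set of proper quasi-$\star_f$-ideals of $D$; these are prime ideals. The semistar operation $\widetilde{\star}$ is defined by $E^{\widetilde{\star}}=\bigcap\{ED_Q : Q\in\mathcal{M}(\star_f)\}$ (an empty intersection being $K$). For $E,F\in\overline{F}(D)$, $(E:F)=\{z\in K: zF\subseteq E\}$. For a semistar operation $\ast$, an element $I\in\overline{F}(D)$ is quasi-$\ast$-invertible if $(I(D^{\ast}:I))^{\ast}=D^{\ast}$ (in particular $(D^{\ast}:I)\ne 0$). *)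

theory Defs
  imports "HOL-Computational_Algebra.Polynomial_Factorial"
begin

text \<open>
  The domain \<open>D\<close> is a type \<open>'a::idom\<close>, its quotient field \<open>K\<close> is \<open>'a fract\<close>, and \<open>D\<close> is regarded as
  a subset of \<open>K\<close> via \<^const>\<open>to_fract\<close>. Ideals of \<open>D\<close> are likewise subsets of \<open>K\<close>.
\<close>

global_interpretation frac: module "\<lambda>(d::'a::idom) (x::'a fract). to_fract d * x"
  defines frac_submodule = frac.subspace
    and frac_span = frac.span
  by unfold_locales (simp_all add: algebra_simps)

definition base_domain :: "'a::idom fract set" where
  "base_domain = range to_fract"

definition nonzero_submodules :: "'a::idom fract set set" where
  "nonzero_submodules = {E. frac_submodule E \<and> E \<noteq> {0}}"

definition fg_submodule :: "'a::idom fract set \<Rightarrow> bool" where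
  "fg_submodule F \<longleftrightarrow> (\<exists>S. finite S \<and> F = frac_span S)"

definition submodule_prod :: "'a::idom fract set \<Rightarrow> 'a fract set \<Rightarrow> 'a fract set" where
  "submodule_prod E F = frac_span {x * y | x y. x \<in> E \<and> y \<in> F}"

definition submodule_colon :: "'a::idom fract set \<Rightarrow> 'a fract set \<Rightarrow> 'a fract set" where
  "submodule_colon E F = {z. (*) z ` F \<subseteq> E}"

text \<open>
  Operations are total functions on sets; only their values on \<^const>\<open>nonzero_submodules\<close> matter.
\<close>

definition semistar :: "('a::idom fract set \<Rightarrow> 'a fract set) \<Rightarrow> bool" where
  "semistar star \<longleftrightarrow>
     (\<forall>E \<in> nonzero_submodules. star E \<in> nonzero_submodules) \<and>
     (\<forall>x. \<forall>E \<in> nonzero_submodules. x \<noteq> 0 \<longrightarrow> star ((*) x ` E) = (*) x ` star E) \<and>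
     (\<forall>E \<in> nonzero_submodules. \<forall>F \<in> nonzero_submodules. E \<subseteq> F \<longrightarrow> star E \<subseteq> star F) \<and>
     (\<forall>E \<in> nonzero_submodules. E \<subseteq> star E \<and> star (star E) = star E)"

definition finite_type :: "('a::idom fract set \<Rightarrow> 'a fract set) \<Rightarrow> 'a fract set \<Rightarrow> 'a fract set" where
  "finite_type star E =
     \<Union> {star F | F. F \<subseteq> E \<and> F \<in> nonzero_submodules \<and> fg_submodule F}"

definition nonzero_ideal :: "'a::idom fract set \<Rightarrow> bool" where
  "nonzero_ideal I \<longleftrightarrow> I \<in> nonzero_submodules \<and> I \<subseteq> base_domain"

definition quasi_ideal :: "('a::idom fract set \<Rightarrow> 'a fract set) \<Rightarrow> 'a fract set \<Rightarrow> bool" where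
  "quasi_ideal star I \<longleftrightarrow> nonzero_ideal I \<and> star I \<inter> base_domain = I"

definition quasi_maximal_ideals :: "('a::idom fract set \<Rightarrow> 'a fract set) \<Rightarrow> 'a fract set set" where
  "quasi_maximal_ideals star =
     {Q. quasi_ideal star Q \<and> Q \<noteq> base_domain \<and>
         (\<forall>J. quasi_ideal star J \<and> J \<noteq> base_domain \<and> Q \<subseteq> J \<longrightarrow> J = Q)}"

definition localization_at :: "'a::idom fract set \<Rightarrow> 'a fract set" where
  "localization_at Q = {a / s | a s. a \<in> base_domain \<and> s \<in> base_domain - Q}"

text \<open>The empty intersection is \<^const>\<open>UNIV\<close>, that is, \<open>K\<close>.\<close>

definition semistar_tilde :: "('a::idom fract set \<Rightarrow> 'a fract set) \<Rightarrow> 'a fract set \<Rightarrow> 'a fract set" where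
  "semistar_tilde star E =
     \<Inter> {submodule_prod E (localization_at Q) | Q. Q \<in> quasi_maximal_ideals (finite_type star)}"

text \<open>
  The first conjunct makes explicit that the product lies in the domain of the operation; the
  value of an operation at the zero module is a junk value.
\<close>

definition quasi_invertible :: "('a::idom fract set \<Rightarrow> 'a fract set) \<Rightarrow> 'a fract set \<Rightarrow> bool" where
  "quasi_invertible star I \<longleftrightarrow>
     submodule_colon (star base_domain) I \<noteq> {0} \<and>
     star (submodule_prod I (submodule_colon (star base_domain) I)) = star base_domain"

end

theory Submission imports Defs begin

text \<open>
  Since \<open>D\<close> is finitely generated over itself, \<open>\<star>\<^sub>f\<close> and \<open>\<star>\<close> agree on \<open>D\<close>; so by hypothesis
  \<open>\<star>\<^sub>f\<close> and the operation \<open>\<star>~\<close> have a common value \<open>D\<^sup>\<star>\<close> on \<open>D\<close>. Both notions of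
  quasi-invertibility therefore speak of the same submodule \<open>J = I(D\<^sup>\<star> : I)\<close> of \<open>D\<^sup>\<star>\<close>. Both
  fail if \<open>(D\<^sup>\<star> : I) = 0\<close>; otherwise it is to be shown that \<open>J\<close> and \<open>D\<close> have the same \<open>\<star>\<^sub>f\<close>-closure iff they have the same \<open>\<star>~\<close>-closure.

  One direction holds because \<open>E\<^bsup>\<star>~\<^esup> \<subseteq> E\<^bsup>\<star>f\<^esup>\<close> for every \<open>E\<close>
  (\<open>semistar_tilde_subset_finite_type\<close>): if \<open>x\<close> lies in \<open>E D\<^sub>Q\<close> for all
  \<open>Q \<in> M(\<star>\<^sub>f)\<close>, then the ideal of denominators \<open>{d \<in> D. d x \<in> E}\<close> is contained in no such \<open>Q\<close>.
  By Zorn's lemma, which is applicable because \<open>\<star>\<^sub>f\<close> is of finite type, the \<open>\<star>\<^sub>f\<close>-closure of that ideal contains \<open>1\<close>, and multiplying by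
  \<open>x\<close> gives \<open>x \<in> E\<^bsup>\<star>f\<^esup>\<close>.

  For the other direction (\<open>one_in_localization\<close>) fix \<open>Q \<in> M(\<star>\<^sub>f)\<close>. If \<open>1 \<in> J\<^bsup>\<star>f\<^esup>\<close>, then
  \<open>1 \<in> F\<^sup>\<star>\<close> for a finitely generated \<open>F \<subseteq> J\<close>. As \<open>J \<subseteq> D\<^sup>\<star> = D\<^bsup>\<star>~\<^esup> \<subseteq> D\<^sub>Q\<close>, the generators of \<open>F\<close>
  have a common denominator \<open>s \<in> D - Q\<close>, and \<open>s \<in> (sF)\<^sup>\<star>\<close>. Hence the ideal \<open>sF\<close> is not contained
  in \<open>Q\<close>, which says that \<open>J\<close> generates the unit ideal of \<open>D\<^sub>Q\<close>. This is where
  the hypothesis \<open>D\<^sup>\<star> = D\<^bsup>\<star>~\<^esup>\<close> is decisive: it makes \<open>J\<close> integral at \<open>Q\<close>.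
\<close>

section \<open>Submodules of the quotient field\<close>

lemma frac_submodule_mult:
  "frac_submodule E \<Longrightarrow> a \<in> base_domain \<Longrightarrow> x \<in> E \<Longrightarrow> a * x \<in> E"
  by (auto simp: base_domain_def dest: frac.subspace_scale)

lemma one_in_base_domain: "1 \<in> base_domain"
  unfolding base_domain_def by (metis rangeI to_fract_1)

lemma mult_in_base_domain: "a \<in> base_domain \<Longrightarrow> b \<in> base_domain \<Longrightarrow> a * b \<in> base_domain"
  by (auto simp: base_domain_def simp flip: to_fract_mult)

lemma frac_submodule_base_domain: "frac_submodule base_domain"
  by (rule frac.subspaceI)
     (auto simp: base_domain_def simp flip: to_fract_0 to_fract_add to_fract_mult)

lemma base_domain_nonzero_submodule: "base_domain \<in> nonzero_submodules"
  using frac_submodule_base_domain one_in_base_domain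
  unfolding nonzero_submodules_def by (metis (mono_tags) mem_Collect_eq singletonD zero_neq_one)

lemma frac_span_one: "frac_span {1 :: 'a::idom fract} = base_domain"
proof (rule antisym)
  show "frac_span {1 :: 'a fract} \<subseteq> base_domain"
    using one_in_base_domain frac_submodule_base_domain by (intro frac.span_minimal) auto
  have "to_fract d * 1 \<in> frac_span {1}" for d :: 'a
    by (intro frac.span_scale frac.span_base) simp
  then show "base_domain \<subseteq> frac_span {1 :: 'a fract}"
    by (auto simp: base_domain_def)
qed

lemma nonzero_submodulesI: "frac_submodule E \<Longrightarrow> x \<in> E \<Longrightarrow> x \<noteq> 0 \<Longrightarrow> E \<in> nonzero_submodules"
  by (auto simp: nonzero_submodules_def)

lemma nonzero_submodulesE:
  assumes "E \<in> nonzero_submodules"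
  obtains x where "x \<in> E" "x \<noteq> 0"
  using assms frac.subspace_0[of E] by (auto simp: nonzero_submodules_def)

lemma nonzero_submodules_superset:
  "E \<in> nonzero_submodules \<Longrightarrow> frac_submodule F \<Longrightarrow> E \<subseteq> F \<Longrightarrow> F \<in> nonzero_submodules"
  by (meson nonzero_submodulesE nonzero_submodulesI subsetD)

lemma nonzero_submodulesD: "E \<in> nonzero_submodules \<Longrightarrow> frac_submodule E"
  by (simp add: nonzero_submodules_def)

lemma frac_span_times: "frac_span ((*) x ` S) = (*) x ` frac_span S"
proof (rule antisym)
  have sub: "frac_submodule ((*) y ` E)" if "frac_submodule E" for y :: "'a fract" and E
  proof (rule frac.subspaceI)
    show "0 \<in> (*) y ` E"
      using frac.subspace_0[OF that] by force
    fix a b assume "a \<in> (*) y ` E" "b \<in> (*) y ` E"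
    then show "a + b \<in> (*) y ` E"
      using frac.subspace_add[OF that] by (auto simp flip: distrib_left)
  next
    fix c b assume "b \<in> (*) y ` E"
    then show "to_fract c * b \<in> (*) y ` E"
      using frac.subspace_scale[OF that] by (force simp: mult.left_commute)
  qed
  show "frac_span ((*) x ` S) \<subseteq> (*) x ` frac_span S"
    by (intro frac.span_minimal sub) (auto intro: frac.span_base)
  have "frac_span S \<subseteq> {z. x * z \<in> frac_span ((*) x ` S)}"
  proof (rule frac.span_minimal)
    show "frac_submodule {z. x * z \<in> frac_span ((*) x ` S)}"
      by (rule frac.subspaceI)
         (auto simp: frac.span_zero distrib_left mult.left_commute[of x]
               intro: frac.span_add frac.span_scale)
  qed (auto intro: frac.span_base)
  then show "(*) x ` frac_span S \<subseteq> frac_span ((*) x ` S)"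
    by auto
qed

lemma times_nonzero_submodule:
  assumes "E \<in> nonzero_submodules" "x \<noteq> 0"
  shows "(*) x ` E \<in> nonzero_submodules"
proof -
  have E: "frac_submodule E"
    using assms(1) by (rule nonzero_submodulesD)
  obtain e where "e \<in> E" "e \<noteq> 0"
    using assms(1) by (rule nonzero_submodulesE)
  moreover have "frac_submodule ((*) x ` E)"
    by (metis E frac.span_eq_iff frac_span_times)
  ultimately show ?thesis
    using assms(2) by (intro nonzero_submodulesI[of _ "x * e"]) auto
qed

lemma submodule_colon_submodule:
  assumes "frac_submodule E"
  shows "frac_submodule (submodule_colon E F)"
  using frac.subspace_0[OF assms] frac.subspace_add[OF assms] frac.subspace_scale[OF assms]
  by (intro frac.subspaceI)
     (auto simp: submodule_colon_def distrib_right mult.assoc image_subset_iff)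

lemma submodule_prod_nonzero:
  assumes "E \<in> nonzero_submodules" "F \<in> nonzero_submodules"
  shows "submodule_prod E F \<in> nonzero_submodules"
proof -
  obtain x y where "x \<in> E" "x \<noteq> 0" "y \<in> F" "y \<noteq> 0"
    using assms by (metis nonzero_submodulesE)
  then show ?thesis
    unfolding submodule_prod_def
    by (intro nonzero_submodulesI[of _ "x * y"] frac.subspace_span frac.span_base) auto
qed

text \<open>
  Elements of the quotient field have denominators even relative to an arbitrary nonzero submodule:
  write \<open>x / e\<close>, with \<open>0 \<noteq> e \<in> E\<close>, as a fraction over \<open>D\<close>.
\<close>

lemma exists_denominator:
  assumes "E \<in> nonzero_submodules"
  obtains d where "d \<in> base_domain" "d \<noteq> 0" "d * x \<in> E"
proof -
  obtain e where e: "e \<in> E" "e \<noteq> 0"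
    using assms by (rule nonzero_submodulesE)
  obtain a b where ab: "x / e = Fract a b" "b \<noteq> 0"
    by (cases "x / e") auto
  then have "to_fract b * x = to_fract a * e"
    using e(2) by (simp add: Fract_conv_to_fract field_simps)
  then show thesis
    using that[of "to_fract b"] ab(2) e(1) frac.subspace_scale[OF nonzero_submodulesD[OF assms]]
    by (auto simp: base_domain_def)
qed

text \<open>The ideal of denominators of \<open>x\<close> relative to \<open>E\<close>, also known as \<open>(E :\<^sub>D x)\<close>.\<close>

definition denominators :: "'a::idom fract set \<Rightarrow> 'a fract \<Rightarrow> 'a fract set" where
  "denominators E x = {d \<in> base_domain. d * x \<in> E}"

lemma denominators_ideal:
  assumes "E \<in> nonzero_submodules"
  shows "nonzero_ideal (denominators E x)"
proof -
  have E: "frac_submodule E"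
    using assms by (rule nonzero_submodulesD)
  have "frac_submodule (denominators E x)"
    using frac.subspace_0[OF E] frac.subspace_add[OF E] frac.subspace_scale[OF E]
      frac.subspace_0[OF frac_submodule_base_domain]
      frac.subspace_add[OF frac_submodule_base_domain]
      frac.subspace_scale[OF frac_submodule_base_domain]
    by (intro frac.subspaceI) (auto simp: denominators_def distrib_right mult.assoc)
  moreover obtain d where "d \<in> base_domain" "d \<noteq> 0" "d * x \<in> E"
    using exists_denominator[OF assms] .
  ultimately show ?thesis
    unfolding nonzero_ideal_def
    by (auto simp: denominators_def intro: nonzero_submodulesI[of _ d])
qed

lemma Union_chain_submodule:
  assumes "\<C> \<noteq> {}" "subset.chain \<A> \<C>" "\<And>E. E \<in> \<C> \<Longrightarrow> frac_submodule E"
  shows "frac_submodule (\<Union>\<C>)"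
proof (rule frac.subspaceI)
  obtain E where "E \<in> \<C>"
    using assms(1) by blast
  then show "0 \<in> \<Union>\<C>"
    using frac.subspace_0[OF assms(3)] by (intro UnionI)
next
  fix x y assume "x \<in> \<Union>\<C>" "y \<in> \<Union>\<C>"
  then obtain E F where EF: "E \<in> \<C>" "x \<in> E" "F \<in> \<C>" "y \<in> F" by blast
  then have "E \<subseteq> F \<or> F \<subseteq> E"
    using assms(2) by (auto simp: subset_chain_def)
  then obtain G where G: "G \<in> \<C>" "x \<in> G" "y \<in> G"
    using EF by blast
  then show "x + y \<in> \<Union>\<C>"
    using frac.subspace_add[OF assms(3)[OF G(1)] G(2,3)] by (intro UnionI)
next
  fix c x assume "x \<in> \<Union>\<C>"
  then obtain E where "E \<in> \<C>" "x \<in> E" by blast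
  then show "to_fract c * x \<in> \<Union>\<C>"
    using frac.subspace_scale[OF assms(3)] by (intro UnionI)
qed

section \<open>The operation of finite type\<close>

lemma finite_type_iff:
  "x \<in> finite_type star E \<longleftrightarrow>
     (\<exists>S. finite S \<and> frac_span S \<subseteq> E \<and> frac_span S \<in> nonzero_submodules \<and> x \<in> star (frac_span S))"
  unfolding finite_type_def fg_submodule_def by blast

lemma finite_type_mono: "E \<subseteq> F \<Longrightarrow> finite_type star E \<subseteq> finite_type star F"
  unfolding finite_type_def by blast

context
  fixes star :: "'a::idom fract set \<Rightarrow> 'a fract set"
  assumes semistar: "semistar star"
begin

lemma star_nonzero_submodule: "E \<in> nonzero_submodules \<Longrightarrow> star E \<in> nonzero_submodules"
  and star_times: "E \<in> nonzero_submodules \<Longrightarrow> x \<noteq> 0 \<Longrightarrow> star ((*) x ` E) = (*) x ` star E"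
  and star_mono:
    "E \<in> nonzero_submodules \<Longrightarrow> F \<in> nonzero_submodules \<Longrightarrow> E \<subseteq> F \<Longrightarrow> star E \<subseteq> star F"
  and star_extensive: "E \<in> nonzero_submodules \<Longrightarrow> E \<subseteq> star E"
  and star_idem: "E \<in> nonzero_submodules \<Longrightarrow> star (star E) = star E"
  using semistar by (simp_all add: semistar_def)

lemma finite_type_base_domain: "finite_type star base_domain = star base_domain"
proof (rule antisym)
  show "finite_type star base_domain \<subseteq> star base_domain"
    using star_mono base_domain_nonzero_submodule unfolding finite_type_def by blast
  have "fg_submodule base_domain"
    unfolding fg_submodule_def using frac_span_one by (metis finite.emptyI finite.insertI)
  then show "star base_domain \<subseteq> finite_type star base_domain"
    using base_domain_nonzero_submodule unfolding finite_type_def by blast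
qed

lemma finite_type_extensive:
  assumes "E \<in> nonzero_submodules"
  shows "E \<subseteq> finite_type star E"
proof
  fix x assume x: "x \<in> E"
  obtain e where e: "e \<in> E" "e \<noteq> 0"
    using assms by (rule nonzero_submodulesE)
  \<comment> \<open>The second generator \<open>e\<close> covers \<open>x = 0\<close>, for which the span of \<open>x\<close> alone is zero.\<close>
  have "frac_span {x, e} \<subseteq> E"
    using x e nonzero_submodulesD[OF assms] by (intro frac.span_minimal) auto
  moreover have *: "frac_span {x, e} \<in> nonzero_submodules"
    using e(2) by (intro nonzero_submodulesI[of _ e] frac.subspace_span frac.span_base) auto
  moreover have "x \<in> star (frac_span {x, e})"
    using star_extensive[OF *] frac.span_base[of x "{x, e}"] by auto
  ultimately show "x \<in> finite_type star E"
    by (auto simp: finite_type_iff intro: exI[of _ "{x, e}"])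
qed

text \<open>
  The union defining \<open>E\<^bsup>\<star>f\<^esup>\<close> is directed, because a sum of finitely generated modules is finitely
  generated; so finitely many of its elements already lie in a single member.
\<close>

lemma finite_subset_finite_type:
  assumes "E \<in> nonzero_submodules" "finite S" "S \<subseteq> finite_type star E"
  obtains T where "finite T" "frac_span T \<subseteq> E" "frac_span T \<in> nonzero_submodules"
    "S \<subseteq> star (frac_span T)"
proof -
  have "\<exists>T. finite T \<and> frac_span T \<subseteq> E \<and> frac_span T \<in> nonzero_submodules
          \<and> S \<subseteq> star (frac_span T)"
    using assms(2,3)
  proof (induction S rule: finite_induct)
    case empty
    have "0 \<in> finite_type star E"
      using finite_type_extensive[OF assms(1)] frac.subspace_0[OF nonzero_submodulesD[OF assms(1)]]
      by blast
    then show ?case by (auto simp: finite_type_iff)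
  next
    case (insert x S)
    then obtain T where T: "finite T" "frac_span T \<subseteq> E" "frac_span T \<in> nonzero_submodules"
      "S \<subseteq> star (frac_span T)" by auto
    obtain U where U: "finite U" "frac_span U \<subseteq> E" "frac_span U \<in> nonzero_submodules"
      "x \<in> star (frac_span U)"
      using insert.prems by (auto simp: finite_type_iff)
    have sub: "frac_span T \<subseteq> frac_span (T \<union> U)" "frac_span U \<subseteq> frac_span (T \<union> U)"
      by (auto intro!: frac.span_mono)
    have "T \<union> U \<subseteq> E"
      using T(2) U(2) frac.span_superset by blast
    then have "frac_span (T \<union> U) \<subseteq> E"
      by (intro frac.span_minimal nonzero_submodulesD[OF assms(1)])
    moreover have *: "frac_span (T \<union> U) \<in> nonzero_submodules"
      using T(3) frac.subspace_span sub(1) by (rule nonzero_submodules_superset)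
    moreover have "insert x S \<subseteq> star (frac_span (T \<union> U))"
      using star_mono[OF T(3) * sub(1)] star_mono[OF U(3) * sub(2)] T(4) U(4) by blast
    ultimately show ?case
      using T(1) U(1) by blast
  qed
  then show thesis using that by blast
qed

lemma finite_type_nonzero_submodule:
  assumes "E \<in> nonzero_submodules"
  shows "finite_type star E \<in> nonzero_submodules"
proof -
  have "frac_submodule (finite_type star E)"
  proof (rule frac.subspaceI)
    show "0 \<in> finite_type star E"
      using finite_type_extensive[OF assms] frac.subspace_0[OF nonzero_submodulesD[OF assms]]
      by blast
  next
    fix x y assume "x \<in> finite_type star E" "y \<in> finite_type star E"
    then obtain T where T: "finite T" "frac_span T \<subseteq> E" "frac_span T \<in> nonzero_submodules"
      "{x, y} \<subseteq> star (frac_span T)"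
      using finite_subset_finite_type[OF assms, of "{x, y}"] by auto
    then have "x + y \<in> star (frac_span T)"
      using frac.subspace_add[OF nonzero_submodulesD[OF star_nonzero_submodule]] by auto
    then show "x + y \<in> finite_type star E"
      using T by (auto simp: finite_type_iff)
  next
    fix c x assume "x \<in> finite_type star E"
    then show "to_fract c * x \<in> finite_type star E"
      using frac.subspace_scale[OF nonzero_submodulesD[OF star_nonzero_submodule]]
      unfolding finite_type_iff by blast
  qed
  with assms show ?thesis
    using finite_type_extensive[OF assms] by (rule nonzero_submodules_superset)
qed

lemma finite_type_idem:
  assumes "E \<in> nonzero_submodules"
  shows "finite_type star (finite_type star E) = finite_type star E"
proof (rule antisym)
  show "finite_type star E \<subseteq> finite_type star (finite_type star E)"
    by (intro finite_type_extensive finite_type_nonzero_submodule assms)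
  show "finite_type star (finite_type star E) \<subseteq> finite_type star E"
  proof
    fix x assume "x \<in> finite_type star (finite_type star E)"
    then obtain S where S: "finite S" "frac_span S \<subseteq> finite_type star E"
      "frac_span S \<in> nonzero_submodules" "x \<in> star (frac_span S)"
      unfolding finite_type_iff by blast
    have "S \<subseteq> finite_type star E"
      using S(2) frac.span_superset by blast
    with S(1) obtain T where T: "finite T" "frac_span T \<subseteq> E"
      "frac_span T \<in> nonzero_submodules" "S \<subseteq> star (frac_span T)"
      by (rule finite_subset_finite_type[OF assms])
    have T': "star (frac_span T) \<in> nonzero_submodules"
      using T(3) by (rule star_nonzero_submodule)
    have "frac_span S \<subseteq> star (frac_span T)"
      using T(4) nonzero_submodulesD[OF T'] by (rule frac.span_minimal)
    then have "star (frac_span S) \<subseteq> star (frac_span T)"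
      using star_mono[OF S(3) T'] star_idem[OF T(3)] by simp
    then show "x \<in> finite_type star E"
      using S(4) T unfolding finite_type_iff by blast
  qed
qed

lemma finite_type_times:
  assumes "x \<noteq> 0" "y \<in> finite_type star E"
  shows "x * y \<in> finite_type star ((*) x ` E)"
proof -
  obtain S where S: "finite S" "frac_span S \<subseteq> E"
    "frac_span S \<in> nonzero_submodules" "y \<in> star (frac_span S)"
    using assms(2) unfolding finite_type_iff by blast
  have "frac_span ((*) x ` S) \<subseteq> (*) x ` E"
    using S(2) by (auto simp: frac_span_times)
  moreover have "frac_span ((*) x ` S) \<in> nonzero_submodules"
    using times_nonzero_submodule[OF S(3) assms(1)] by (simp add: frac_span_times)
  moreover have "x * y \<in> star (frac_span ((*) x ` S))"
    using S(4) star_times[OF S(3) assms(1)] by (auto simp: frac_span_times)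
  ultimately show ?thesis
    using S(1) unfolding finite_type_iff by blast
qed

section \<open>Quasi-maximal ideals\<close>

lemma quasi_ideal_proper_iff:
  assumes "quasi_ideal (finite_type star) Q"
  shows "Q \<noteq> base_domain \<longleftrightarrow> 1 \<notin> Q"
proof -
  have "frac_submodule Q" "Q \<subseteq> base_domain"
    using assms nonzero_submodulesD unfolding quasi_ideal_def nonzero_ideal_def by auto
  then show ?thesis
    using frac_submodule_mult[of Q _ 1] one_in_base_domain by auto
qed

lemma quasi_ideal_closure:
  assumes "nonzero_ideal A"
  shows "quasi_ideal (finite_type star) (finite_type star A \<inter> base_domain)"
proof -
  let ?B = "finite_type star A \<inter> base_domain"
  have A: "A \<in> nonzero_submodules" "A \<subseteq> base_domain"
    using assms by (auto simp: nonzero_ideal_def)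
  have AB: "A \<subseteq> ?B"
    using finite_type_extensive[OF A(1)] A(2) by blast
  have "frac_submodule ?B"
    using nonzero_submodulesD[OF finite_type_nonzero_submodule[OF A(1)]] frac_submodule_base_domain
    by (rule frac.subspace_inter)
  with A(1) have B: "?B \<in> nonzero_submodules"
    using AB by (rule nonzero_submodules_superset)
  have "finite_type star ?B \<subseteq> finite_type star (finite_type star A)"
    by (rule finite_type_mono) simp
  then show ?thesis
    using B finite_type_extensive[OF B] finite_type_idem[OF A(1)]
    unfolding quasi_ideal_def nonzero_ideal_def by auto
qed

text \<open>
  A quasi-\<open>\<star>\<^sub>f\<close>-ideal is recognized by its finitely generated submodules, and a finitely generated
  submodule of the union of a chain is contained in a member of the chain. Hence Zorn's lemma applies.
\<close>

lemma exists_quasi_maximal_ideal: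
  assumes "quasi_ideal (finite_type star) A" "1 \<notin> A"
  obtains Q where "Q \<in> quasi_maximal_ideals (finite_type star)" "A \<subseteq> Q"
proof -
  let ?P = "{J. quasi_ideal (finite_type star) J \<and> 1 \<notin> J \<and> A \<subseteq> J}"
  have "\<exists>Q\<in>?P. \<forall>J\<in>?P. Q \<subseteq> J \<longrightarrow> J = Q"
  proof (rule subset_Zorn_nonempty)
    show "?P \<noteq> {}"
      using assms by blast
    fix \<C> assume \<C>: "\<C> \<noteq> {}" "subset.chain ?P \<C>"
    have mem: "quasi_ideal (finite_type star) J" "1 \<notin> J" "A \<subseteq> J" "J \<subseteq> base_domain"
      "J \<in> nonzero_submodules" if "J \<in> \<C>" for J
      using \<C>(2) that by (auto simp: subset_chain_def quasi_ideal_def nonzero_ideal_def)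
    have "frac_submodule (\<Union>\<C>)"
      by (rule Union_chain_submodule[OF \<C> nonzero_submodulesD[OF mem(5)]])
    moreover obtain J where J: "J \<in> \<C>"
      using \<C>(1) by blast
    ultimately have U: "\<Union>\<C> \<in> nonzero_submodules"
      using mem(5)[OF J] by (intro nonzero_submodules_superset[of J "\<Union>\<C>"]) auto
    have "x \<in> \<Union>\<C>" if x: "x \<in> finite_type star (\<Union>\<C>)" "x \<in> base_domain" for x
    proof -
      obtain S where S: "finite S" "frac_span S \<subseteq> \<Union>\<C>"
        "frac_span S \<in> nonzero_submodules" "x \<in> star (frac_span S)"
        using x(1) unfolding finite_type_iff by blast
      have "S \<subseteq> \<Union>\<C>"
        using S(2) frac.span_superset by blast
      then obtain J where J: "J \<in> \<C>" "S \<subseteq> J"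
        by (rule finite_subset_Union_chain[OF S(1) _ \<C>])
      have "frac_span S \<subseteq> J"
        using J(2) nonzero_submodulesD[OF mem(5)[OF J(1)]] by (rule frac.span_minimal)
      then have "x \<in> finite_type star J"
        using S unfolding finite_type_iff by blast
      then show ?thesis
        using x(2) mem(1)[OF J(1)] J(1) unfolding quasi_ideal_def by blast
    qed
    then have "finite_type star (\<Union>\<C>) \<inter> base_domain \<subseteq> \<Union>\<C>"
      by blast
    moreover have "\<Union>\<C> \<subseteq> base_domain"
      using mem(4) by (rule Union_least)
    ultimately have "quasi_ideal (finite_type star) (\<Union>\<C>)"
      using U finite_type_extensive[OF U] by (auto simp: quasi_ideal_def nonzero_ideal_def)
    moreover have "1 \<notin> \<Union>\<C>"
      using mem(2) by auto
    moreover have "A \<subseteq> \<Union>\<C>"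
      using mem(3)[OF J] J by (rule order_trans[OF _ Union_upper])
    ultimately show "\<Union>\<C> \<in> ?P"
      by simp
  qed
  then obtain Q where Q: "Q \<in> ?P" "\<forall>J\<in>?P. Q \<subseteq> J \<longrightarrow> J = Q"
    by (rule bexE)
  have "Q \<in> quasi_maximal_ideals (finite_type star)"
    unfolding quasi_maximal_ideals_def
  proof (intro CollectI conjI allI impI)
    show "quasi_ideal (finite_type star) Q" "Q \<noteq> base_domain"
      using Q(1) quasi_ideal_proper_iff by auto
    fix J assume "quasi_ideal (finite_type star) J \<and> J \<noteq> base_domain \<and> Q \<subseteq> J"
    moreover from this have "J \<in> ?P"
      using Q(1) quasi_ideal_proper_iff by auto
    ultimately show "J = Q"
      using Q(2) by blast
  qed
  then show thesis
    using that Q(1) by blast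
qed

lemma quasi_maximal_idealD:
  assumes "Q \<in> quasi_maximal_ideals (finite_type star)"
  shows "Q \<in> nonzero_submodules" "Q \<subseteq> base_domain" "1 \<notin> Q"
    "x \<in> finite_type star Q \<Longrightarrow> x \<in> base_domain \<Longrightarrow> x \<in> Q"
    "quasi_ideal (finite_type star) J \<Longrightarrow> 1 \<notin> J \<Longrightarrow> Q \<subseteq> J \<Longrightarrow> J = Q"
proof -
  have Q: "quasi_ideal (finite_type star) Q" "Q \<noteq> base_domain"
    and max: "\<And>J. quasi_ideal (finite_type star) J \<Longrightarrow> J \<noteq> base_domain \<Longrightarrow> Q \<subseteq> J \<Longrightarrow> J = Q"
    using assms by (auto simp: quasi_maximal_ideals_def)
  show "Q \<in> nonzero_submodules" "Q \<subseteq> base_domain"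
    "x \<in> finite_type star Q \<Longrightarrow> x \<in> base_domain \<Longrightarrow> x \<in> Q"
    using Q(1) by (auto simp: quasi_ideal_def nonzero_ideal_def)
  show "1 \<notin> Q"
    using Q quasi_ideal_proper_iff by simp
  show "quasi_ideal (finite_type star) J \<Longrightarrow> 1 \<notin> J \<Longrightarrow> Q \<subseteq> J \<Longrightarrow> J = Q"
    using quasi_ideal_proper_iff by (intro max) simp_all
qed

text \<open>
  Primality: for \<open>b \<notin> Q\<close> the ideal \<open>(Q :\<^sub>D b)\<close> is again a proper quasi-\<open>\<star>\<^sub>f\<close>-ideal and contains
  \<open>Q\<close>, so by maximality it is \<open>Q\<close>; hence \<open>a b \<in> Q\<close> forces \<open>a \<in> Q\<close>.
\<close>

lemma quasi_maximal_ideal_prime: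
  assumes Q: "Q \<in> quasi_maximal_ideals (finite_type star)"
    and a: "a \<in> base_domain - Q" and b: "b \<in> base_domain - Q"
  shows "a * b \<in> base_domain - Q"
proof -
  note Qs = nonzero_submodulesD[OF quasi_maximal_idealD(1)[OF Q]]
  let ?J = "denominators Q b"
  have b0: "b \<noteq> 0"
    using b frac.subspace_0[OF Qs] by blast
  have ideal: "nonzero_ideal ?J"
    using quasi_maximal_idealD(1)[OF Q] by (rule denominators_ideal)
  have "x \<in> ?J" if x: "x \<in> finite_type star ?J" "x \<in> base_domain" for x
  proof -
    have "b * x \<in> finite_type star ((*) b ` ?J)"
      using b0 x(1) by (rule finite_type_times)
    moreover have "(*) b ` ?J \<subseteq> Q"
      by (auto simp: denominators_def mult.commute)
    ultimately have "b * x \<in> finite_type star Q"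
      using finite_type_mono by blast
    then show ?thesis
      using quasi_maximal_idealD(4)[OF Q] b x(2)
      by (auto simp: denominators_def mult.commute intro: mult_in_base_domain)
  qed
  then have "quasi_ideal (finite_type star) ?J"
    using ideal finite_type_extensive unfolding quasi_ideal_def nonzero_ideal_def by blast
  moreover have "1 \<notin> ?J"
    using b by (simp add: denominators_def)
  moreover have "Q \<subseteq> ?J"
    using quasi_maximal_idealD(2)[OF Q] frac_submodule_mult[OF Qs, of b] b
    by (auto simp: denominators_def mult.commute)
  ultimately have "?J = Q"
    using quasi_maximal_idealD(5)[OF Q] by blast
  then show ?thesis
    using a b by (auto simp: denominators_def intro: mult_in_base_domain)
qed

section \<open>Localization at quasi-maximal ideals\<close>

text \<open>
  Membership in \<open>E D\<^sub>Q\<close> means having a denominator outside \<open>Q\<close>; closure under sums comes from the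
  product of denominators, by primality of \<open>Q\<close>.
\<close>

lemma submodule_prod_localization_iff:
  assumes Q: "Q \<in> quasi_maximal_ideals (finite_type star)" and E: "frac_submodule E"
  shows "x \<in> submodule_prod E (localization_at Q) \<longleftrightarrow> (\<exists>s \<in> base_domain - Q. s * x \<in> E)"
proof
  note Qs = nonzero_submodulesD[OF quasi_maximal_idealD(1)[OF Q]]
  have nz: "s \<noteq> 0" if "s \<in> base_domain - Q" for s
    using that frac.subspace_0[OF Qs] by blast
  let ?L = "{x. \<exists>s \<in> base_domain - Q. s * x \<in> E}"
  have "frac_submodule ?L"
  proof (rule frac.subspaceI)
    show "0 \<in> ?L"
      using one_in_base_domain quasi_maximal_idealD(3)[OF Q] frac.subspace_0[OF E] by force
  next
    fix x y assume "x \<in> ?L" "y \<in> ?L"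
    then obtain s t where s: "s \<in> base_domain - Q" "s * x \<in> E"
      and t: "t \<in> base_domain - Q" "t * y \<in> E" by blast
    have "t * (s * x) + s * (t * y) \<in> E"
      using s t frac_submodule_mult[OF E] by (intro frac.subspace_add[OF E]) simp_all
    then have "(s * t) * (x + y) \<in> E"
      by (simp add: algebra_simps)
    then show "x + y \<in> ?L"
      using quasi_maximal_ideal_prime[OF Q s(1) t(1)] by blast
  next
    fix c x assume "x \<in> ?L"
    then show "to_fract c * x \<in> ?L"
      using frac.subspace_scale[OF E] by (force simp: mult.left_commute)
  qed
  moreover have "e * (a / s) \<in> ?L"
    if "e \<in> E" "a \<in> base_domain" "s \<in> base_domain - Q" for e a s
  proof -
    have "s * (e * (a / s)) = a * e"
      using nz[OF that(3)] by simp
    then show ?thesis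
      using that frac_submodule_mult[OF E] by (metis (mono_tags, lifting) mem_Collect_eq)
  qed
  ultimately have "submodule_prod E (localization_at Q) \<subseteq> ?L"
    unfolding submodule_prod_def by (intro frac.span_minimal) (auto simp: localization_at_def)
  then show "x \<in> submodule_prod E (localization_at Q) \<Longrightarrow> \<exists>s \<in> base_domain - Q. s * x \<in> E"
    by blast
  assume "\<exists>s \<in> base_domain - Q. s * x \<in> E"
  then obtain s where s: "s \<in> base_domain - Q" "s * x \<in> E" by blast
  have "x = (s * x) * (1 / s)"
    using nz[OF s(1)] by simp
  moreover have "1 / s \<in> localization_at Q"
    using s(1) one_in_base_domain by (auto simp: localization_at_def)
  ultimately show "x \<in> submodule_prod E (localization_at Q)"
    unfolding submodule_prod_def using s(2) by (intro frac.span_base) blast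
qed

lemma semistar_tilde_iff:
  assumes "frac_submodule E"
  shows "x \<in> semistar_tilde star E \<longleftrightarrow>
    (\<forall>Q \<in> quasi_maximal_ideals (finite_type star). \<exists>s \<in> base_domain - Q. s * x \<in> E)"
  unfolding semistar_tilde_def using submodule_prod_localization_iff[OF _ assms] by blast

text \<open>
  Monotonicity and idempotency of \<open>\<star>~\<close> in a single rule: denominators outside \<open>Q\<close> compose, by
  primality.
\<close>

lemma semistar_tilde_subsetI:
  assumes E: "frac_submodule E" and F: "frac_submodule F" and sub: "F \<subseteq> semistar_tilde star E"
  shows "semistar_tilde star F \<subseteq> semistar_tilde star E"
proof
  fix x assume x: "x \<in> semistar_tilde star F"
  show "x \<in> semistar_tilde star E"
    unfolding semistar_tilde_iff[OF E]
  proof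
    fix Q assume Q: "Q \<in> quasi_maximal_ideals (finite_type star)"
    obtain s where s: "s \<in> base_domain - Q" "s * x \<in> F"
      using x Q unfolding semistar_tilde_iff[OF F] by blast
    then obtain t where t: "t \<in> base_domain - Q" "t * (s * x) \<in> E"
      using sub Q semistar_tilde_iff[OF E] by blast
    then show "\<exists>s \<in> base_domain - Q. s * x \<in> E"
      using quasi_maximal_ideal_prime[OF Q t(1) s(1)]
      by (intro bexI[of _ "t * s"]) (simp_all add: mult.assoc)
  qed
qed

text \<open>
  The denominators of \<open>x\<close> relative to \<open>E\<close> form an ideal contained in no quasi-maximal ideal, so its
  \<open>\<star>\<^sub>f\<close>-closure contains \<open>1\<close>.
\<close>

lemma semistar_tilde_subset_finite_type:
  assumes E: "E \<in> nonzero_submodules"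
  shows "semistar_tilde star E \<subseteq> finite_type star E"
proof
  fix x assume x: "x \<in> semistar_tilde star E"
  show "x \<in> finite_type star E"
  proof (cases "x = 0")
    case True
    then show ?thesis
      using finite_type_extensive[OF E] frac.subspace_0[OF nonzero_submodulesD[OF E]] by blast
  next
    case False
    let ?A = "denominators E x"
    have ideal: "nonzero_ideal ?A"
      using E by (rule denominators_ideal)
    have "1 \<in> finite_type star ?A"
    proof (rule ccontr)
      assume "1 \<notin> finite_type star ?A"
      then obtain Q where Q: "Q \<in> quasi_maximal_ideals (finite_type star)"
        "finite_type star ?A \<inter> base_domain \<subseteq> Q"
        using exists_quasi_maximal_ideal[OF quasi_ideal_closure[OF ideal]] by blast
      obtain s where "s \<in> base_domain - Q" "s * x \<in> E"
        using x Q(1) semistar_tilde_iff[OF nonzero_submodulesD[OF E]] by blast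
      then show False
        using Q(2) ideal finite_type_extensive[of ?A]
        by (auto simp: denominators_def nonzero_ideal_def)
    qed
    then have "x * 1 \<in> finite_type star ((*) x ` ?A)"
      by (rule finite_type_times[OF False])
    moreover have "finite_type star ((*) x ` ?A) \<subseteq> finite_type star E"
      by (rule finite_type_mono) (auto simp: denominators_def mult.commute)
    ultimately show ?thesis
      by auto
  qed
qed

lemma common_denominator:
  assumes Q: "Q \<in> quasi_maximal_ideals (finite_type star)" and E: "frac_submodule E"
    and "finite S" "\<And>x. x \<in> S \<Longrightarrow> \<exists>s \<in> base_domain - Q. s * x \<in> E"
  obtains s where "s \<in> base_domain - Q" "(*) s ` S \<subseteq> E"
proof -
  have "\<exists>s \<in> base_domain - Q. (*) s ` S \<subseteq> E"
    using assms(3,4)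
  proof (induction S rule: finite_induct)
    case empty
    then show ?case
      using one_in_base_domain quasi_maximal_idealD(3)[OF Q] by blast
  next
    case (insert x S)
    then obtain s where s: "s \<in> base_domain - Q" "(*) s ` S \<subseteq> E"
      by auto
    obtain t where t: "t \<in> base_domain - Q" "t * x \<in> E"
      using insert.prems[of x] by auto
    have "s * t * x \<in> E"
      using frac_submodule_mult[OF E _ t(2), of s] s(1) by (simp add: mult.assoc)
    moreover have "s * t * y \<in> E" if "y \<in> S" for y
      using frac_submodule_mult[OF E, of t "s * y"] s(2) t(1) that by (auto simp: mult_ac)
    ultimately show ?case
      using quasi_maximal_ideal_prime[OF Q s(1) t(1)]
      by (intro bexI[of _ "s * t"]) auto
  qed
  then show thesis using that by blast
qed

text \<open>
  Passing from \<open>1 \<in> J\<^bsup>\<star>f\<^esup>\<close> to \<open>1 \<in> J D\<^sub>Q\<close>: integrality of \<open>J\<close> at \<open>Q\<close> lets a finitely generated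
  witness \<open>F \<subseteq> J\<close> be scaled by some \<open>s \<in> D - Q\<close> into an ideal \<open>sF\<close> of \<open>D\<close>. Since \<open>s \<in> (sF)\<^sup>\<star>\<close>
  and \<open>Q\<close> is a quasi-\<open>\<star>\<^sub>f\<close>-ideal, \<open>sF \<subseteq> Q\<close> would give \<open>s \<in> Q\<close>.
\<close>

lemma one_in_localization:
  assumes J: "J \<in> nonzero_submodules" "J \<subseteq> semistar_tilde star base_domain"
    and one: "1 \<in> finite_type star J" and Q: "Q \<in> quasi_maximal_ideals (finite_type star)"
  obtains u where "u \<in> J" "u \<in> base_domain - Q"
proof -
  obtain S where S: "finite S" "frac_span S \<subseteq> J"
    "frac_span S \<in> nonzero_submodules" "1 \<in> star (frac_span S)"
    using one unfolding finite_type_iff by blast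
  have "S \<subseteq> J"
    using S(2) frac.span_superset by blast
  then have "\<exists>s \<in> base_domain - Q. s * x \<in> base_domain" if "x \<in> S" for x
    using J(2) Q semistar_tilde_iff[OF frac_submodule_base_domain] that by blast
  then obtain s where s: "s \<in> base_domain - Q" "(*) s ` S \<subseteq> base_domain"
    by (rule common_denominator[OF Q frac_submodule_base_domain S(1)])
  let ?F = "(*) s ` frac_span S"
  have s0: "s \<noteq> 0"
    using s(1) frac.subspace_0[OF nonzero_submodulesD[OF quasi_maximal_idealD(1)[OF Q]]] by blast
  have "1 \<in> finite_type star (frac_span S)"
    using S unfolding finite_type_iff by blast
  then have "s \<in> finite_type star ?F"
    using finite_type_times[OF s0, of 1] by simp
  then have "\<not> ?F \<subseteq> Q"
    using s(1) finite_type_mono[of ?F Q star] quasi_maximal_idealD(4)[OF Q, of s] by blast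
  then obtain u where u: "u \<in> ?F" "u \<notin> Q" by blast
  have "?F \<subseteq> base_domain"
    using s(2) frac_submodule_base_domain
    unfolding frac_span_times[symmetric] by (rule frac.span_minimal)
  moreover have "?F \<subseteq> J"
    using S(2) s(1) frac_submodule_mult[OF nonzero_submodulesD[OF J(1)]] by blast
  ultimately show thesis
    using that u by blast
qed

section \<open>Comparison of the two closures\<close>

text \<open>
  Both closures of \<open>J\<close> are contained in \<open>D\<^sup>\<star>\<close>, their common value on \<open>D\<close>, so each equality is the
  question whether the closure reaches \<open>1\<close>.
\<close>

lemma finite_type_eq_iff_semistar_tilde_eq:
  assumes eq: "star base_domain = semistar_tilde star base_domain"
    and J: "J \<in> nonzero_submodules" "J \<subseteq> star base_domain"
  shows "finite_type star J = star base_domain \<longleftrightarrow> semistar_tilde star J = star base_domain"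
proof
  note Js = nonzero_submodulesD[OF J(1)]
  assume f: "finite_type star J = star base_domain"
  show "semistar_tilde star J = star base_domain"
  proof (rule antisym)
    show "semistar_tilde star J \<subseteq> star base_domain"
      using semistar_tilde_subsetI[OF frac_submodule_base_domain Js] J(2) eq by simp
    have one: "1 \<in> finite_type star J"
      using f one_in_base_domain star_extensive[OF base_domain_nonzero_submodule] by blast
    have "d \<in> semistar_tilde star J" if d: "d \<in> base_domain" for d
      unfolding semistar_tilde_iff[OF Js]
    proof
      fix Q assume "Q \<in> quasi_maximal_ideals (finite_type star)"
      then obtain u where "u \<in> J" "u \<in> base_domain - Q"
        using one_in_localization[OF J(1) _ one] J(2) eq by auto
      then show "\<exists>s \<in> base_domain - Q. s * d \<in> J"
        using frac_submodule_mult[OF Js d] by (auto simp: mult.commute)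
    qed
    then show "star base_domain \<subseteq> semistar_tilde star J"
      using semistar_tilde_subsetI[OF Js frac_submodule_base_domain] eq by blast
  qed
next
  assume t: "semistar_tilde star J = star base_domain"
  have "finite_type star J \<subseteq> finite_type star (finite_type star base_domain)"
    using J(2) finite_type_base_domain by (intro finite_type_mono) simp
  then have "finite_type star J \<subseteq> star base_domain"
    using finite_type_idem[OF base_domain_nonzero_submodule] finite_type_base_domain by simp
  then show "finite_type star J = star base_domain"
    using t semistar_tilde_subset_finite_type[OF J(1)] by blast
qed

end

theorem proposition2p21:
  fixes star :: "'a::idom fract set \<Rightarrow> 'a fract set" and I :: "'a fract set"
  assumes "semistar star"
    and "star base_domain = semistar_tilde star base_domain"
    and "I \<in> nonzero_submodules"
  shows "quasi_invertible (finite_type star) I \<longleftrightarrow> quasi_invertible (semistar_tilde star) I"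
proof -
  let ?C = "submodule_colon (star base_domain) I"
  let ?J = "submodule_prod I ?C"
  have Ds: "frac_submodule (star base_domain)"
    using star_nonzero_submodule[OF assms(1) base_domain_nonzero_submodule]
    by (rule nonzero_submodulesD)
  have "finite_type star ?J = star base_domain \<longleftrightarrow> semistar_tilde star ?J = star base_domain"
    if "?C \<noteq> {0}"
  proof (rule finite_type_eq_iff_semistar_tilde_eq[OF assms(1,2)])
    have "?C \<in> nonzero_submodules"
      using that submodule_colon_submodule[OF Ds] by (simp add: nonzero_submodules_def)
    with assms(3) show "?J \<in> nonzero_submodules"
      by (rule submodule_prod_nonzero)
    show "?J \<subseteq> star base_domain"
      unfolding submodule_prod_def using Ds
      by (intro frac.span_minimal) (auto simp: submodule_colon_def mult.commute)
  qed
  then show ?thesis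
    unfolding quasi_invertible_def finite_type_base_domain[OF assms(1)] assms(2)[symmetric]
    by blast
qed

end
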